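(* Let $M$ be a Polish space, $\pi\in\mathcal P(M)$, let $\{W_n\}_{n\in\mathbb N}$ be a stable and confining sequence of symmetric measurable functions $W_n:M^n\to(-\infty,\infty]$, and let $W:\mathcal P(M)\to(-\infty,\infty]$ be the positive temperature macroscopic limit or the zero temperature macroscopic limit of $\{W_n\}_{n\in\mathbb N}$. Then for every bounded continuous function $f:\mathcal P(M)\to\mathbb R$, $$\inf_{M^n}\{W_n+f\circ i_n\}\ \xrightarrow[n\to\infty]{}\ \inf_{\mathcal P(M)}\{W+f\}.$$
   Context: $\mathcal P(M)$ is the space of Borel probability measures on $M$ with the weak topology; $i_n(x_1,\dots,x_n)=\frac1n\sum_{i=1}^n\delta_{x_i}$; $D(\mu\|\pi)=\int\frac{d\mu}{d\pi}\log\frac{d\mu}{d\pi}\,d\pi$ if $\mu\ll\pi$ and $\infty$ otherwise. For symmetric measurable $W_n:M^n\to(-\infty,\infty]$ define $\tilde W_n:\mathcal P(M)\to(-\infty,\infty]$ by $\tilde W_n(\mu)=W_n(x_1,\dots,x_n)$ if $\mu=\frac1n\sum_{i=1}^n\delta_{x_i}$ for some $(x_1,\dots,x_n)\in M^n$, and $\tilde W_n(\mu)=\infty$ otherwise. Stable sequence: there is $C\in\mathbb R$ with $W_n\ge C$ for all $n$. Confining sequence: for every increasing sequence $\{n_j\}$ of natural numbers and every sequence $\{\mu_j\}$ in $\mathcal P(M)$, if there is a real $A$ with $\tilde W_{n_j}(\mu_j)\le A$ for all $j$, then $\{\mu_j\}$ is relatively compact in $\mathcal P(M)$. (A1): whenever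 $\mu_n\to\mu$ in $\mathcal P(M)$, $\liminf_n\tilde W_n(\mu_n)\ge W(\mu)$. (A2): for each $\mu\in\mathcal P(M)$, $\limsup_n\mathbb E_{\mu^{\otimes n}}[W_n]\le W(\mu)$. (A2'): with $\mathcal N=\{\mu\in\mathcal P(M):D(\mu\|\pi)<\infty,\ \limsup_n\mathbb E_{\mu^{\otimes n}}[W_n]\le W(\mu)\}$, for every $\mu$ with $W(\mu)<\infty$ there is a sequence $\{\mu_n\}$ in $\mathcal N$ with $\mu_n\to\mu$ and $\limsup_nW(\mu_n)\le W(\mu)$. For a stable sequence, a measurable $W:\mathcal P(M)\to(-\infty,\infty]$ is the positive temperature macroscopic limit if (A1) and (A2) hold, and the zero temperature macroscopic limit if (A1) and (A2') hold. *)

theory Defs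
  imports "HOL-Probability.Probability" "HOL-Combinatorics.Permutations"
begin

text \<open>
  \<open>\<P>(M)\<close> is the carrier \<^term>\<open>space (prob_algebra borel)\<close>: the probability measures
  whose \<open>\<sigma>\<close>-algebra is the Borel one. Functions on \<open>\<P>(M)\<close> are total functions on
  \<^typ>\<open>'a measure\<close>; their values outside this carrier are never used.
\<close>

abbreviation borel_probs :: "'a::topological_space measure set"
  where "borel_probs \<equiv> space (prob_algebra borel)"

text \<open>The coarsest topology on \<open>\<P>(M)\<close> making \<open>\<mu> \<mapsto> \<integral>g d\<mu>\<close> continuous for all \<open>g \<in> C\<^sub>b(M)\<close>.\<close>

definition weak_topology :: "'a::topological_space measure topology"
  where "weak_topology = topology_generated_by
    {{\<mu> \<in> borel_probs. (\<integral>x. g x \<partial>\<mu>) \<in> U} | (g :: 'a \<Rightarrow> real) U.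
       continuous_on UNIV g \<and> bounded (range g) \<and> open U}"

lemma topspace_weak_topology [simp]:
  "topspace weak_topology = (borel_probs :: 'a::topological_space measure set)"
proof -
  have "borel_probs \<in> {{\<mu> \<in> borel_probs. (\<integral>x. g x \<partial>\<mu>) \<in> U} | (g :: 'a \<Rightarrow> real) U.
       continuous_on UNIV g \<and> bounded (range g) \<and> open U}"
    by (intro CollectI exI[of _ "\<lambda>_. 0"] exI[of _ UNIV]) auto
  then show ?thesis
    unfolding weak_topology_def topology_generated_by_topspace by blast
qed

definition weak_borel :: "'a::topological_space measure measure"
  where "weak_borel = sigma borel_probs {U. openin weak_topology U}"

definition relatively_compact_in :: "'a topology \<Rightarrow> 'a set \<Rightarrow> bool"
  where "relatively_compact_in X S \<longleftrightarrow> S \<subseteq> topspace X \<and> compactin X (X closure_of S)"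

text \<open>
  \<open>M\<^sup>n\<close> is the set of extensional functions on \<open>{..<n}\<close>, with the product \<open>\<sigma>\<close>-algebra; since
  \<open>M\<close> is second countable, this is the Borel \<open>\<sigma>\<close>-algebra of the product topology.
\<close>

abbreviation config_space :: "nat \<Rightarrow> (nat \<Rightarrow> 'a::topological_space) measure"
  where "config_space n \<equiv> (\<Pi>\<^sub>M i\<in>{..<n}. borel)"

abbreviation configs :: "nat \<Rightarrow> (nat \<Rightarrow> 'a::topological_space) set"
  where "configs n \<equiv> {..<n} \<rightarrow>\<^sub>E UNIV"

definition empirical :: "nat \<Rightarrow> (nat \<Rightarrow> 'a::topological_space) \<Rightarrow> 'a measure"
  where "empirical n x = measure_of UNIV (sets borel)
    (\<lambda>A. (\<Sum>i<n. emeasure (return borel (x i)) A) / of_nat n)"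

lemma sets_empirical: "sets (empirical n x) = sets borel"
  by (simp add: empirical_def sets.sigma_sets_eq[of borel, simplified])

lemma emeasure_empirical:
  fixes x :: "nat \<Rightarrow> 'a::topological_space"
  assumes "A \<in> sets borel"
  shows "emeasure (empirical n x) A = (\<Sum>i<n. emeasure (return borel (x i)) A) / of_nat n"
proof (rule emeasure_measure_of[OF empirical_def])
  show "countably_additive (sets (empirical n x))
     (\<lambda>A. (\<Sum>i<n. emeasure (return borel (x i)) A) / of_nat n)"
  proof (rule countably_additiveI)
    fix F :: "nat \<Rightarrow> 'a set"
    assume F: "range F \<subseteq> sets (empirical n x)" "disjoint_family F"
    then have F': "range F \<subseteq> sets borel"
      by (simp add: sets_empirical)
    have "(\<Sum>k. (\<Sum>i<n. emeasure (return borel (x i)) (F k)) / of_nat n)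
        = (\<Sum>i<n. \<Sum>k. emeasure (return borel (x i)) (F k)) / of_nat n"
      by (simp add: divide_ennreal_def suminf_sum)
    also have "(\<Sum>i<n. \<Sum>k. emeasure (return borel (x i)) (F k))
        = (\<Sum>i<n. emeasure (return borel (x i)) (\<Union>k. F k))"
      using F' F(2) by (intro sum.cong refl suminf_emeasure) auto
    finally show "(\<Sum>k. (\<Sum>i<n. emeasure (return borel (x i)) (F k)) / of_nat n)
        = (\<Sum>i<n. emeasure (return borel (x i)) (\<Union>k. F k)) / of_nat n" .
  qed
qed (use assms in \<open>simp_all add: positive_def sets_empirical\<close>)

lemma empirical_in_borel_probs: "n \<ge> 1 \<Longrightarrow> empirical n x \<in> borel_probs"
proof -
  assume n: "n \<ge> 1"
  have "sets (empirical n x) = sets borel" "space (empirical n x) = UNIV"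
    by (simp_all add: sets_empirical) (simp add: empirical_def)
  moreover have "emeasure (empirical n x) UNIV = 1"
    using n by (simp add: emeasure_empirical ennreal_divide_self ennreal_of_nat_eq_real_of_nat)
  ultimately show ?thesis
    by (auto simp: space_prob_algebra intro!: prob_spaceI)
qed

text \<open>
  Integral of an extended-real-valued function whose negative (or positive) part is
  integrable. It is only applied to functions that are bounded below on a probability space.
\<close>

definition ereal_integral :: "'b measure \<Rightarrow> ('b \<Rightarrow> ereal) \<Rightarrow> ereal"
  where "ereal_integral N h =
    enn2ereal (\<integral>\<^sup>+x. e2ennreal (h x) \<partial>N) - enn2ereal (\<integral>\<^sup>+x. e2ennreal (- h x) \<partial>N)"

text \<open>
  \<open>D(\<mu>\<parallel>\<pi>)\<close>. The library's real-valued \<^const>\<open>KL_divergence\<close> is not used, since it is \<open>0\<close> when the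
  integral is infinite. Here \<^term>\<open>ln 0 = (0::real)\<close> gives \<open>0 log 0 = 0\<close>.
\<close>

definition rel_entropy :: "'a measure \<Rightarrow> 'a measure \<Rightarrow> ereal"
  where "rel_entropy \<mu> \<pi> =
    (if absolutely_continuous \<pi> \<mu>
     then ereal_integral \<pi>
       (\<lambda>x. ereal (enn2real (RN_deriv \<pi> \<mu> x) * ln (enn2real (RN_deriv \<pi> \<mu> x))))
     else \<infinity>)"

text \<open>
  All conditions on \<open>W\<^sub>n\<close> concern \<open>n \<ge> 1\<close>, as \<open>i\<^sub>n\<close> does.
\<close>

definition energy_sequence :: "(nat \<Rightarrow> (nat \<Rightarrow> 'a::topological_space) \<Rightarrow> ereal) \<Rightarrow> bool"
  where "energy_sequence W \<longleftrightarrow> (\<forall>n\<ge>1.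
    W n \<in> borel_measurable (config_space n) \<and>
    (\<forall>x\<in>configs n. W n x > -\<infinity>) \<and>
    (\<forall>x\<in>configs n. \<forall>p. p permutes {..<n} \<longrightarrow> W n (x \<circ> p) = W n x))"

text \<open>
  The choice of the configuration is immaterial for symmetric \<open>W\<^sub>n\<close>, because two configurations with
  the same empirical measure differ by a permutation.
\<close>

definition tilde :: "(nat \<Rightarrow> (nat \<Rightarrow> 'a::topological_space) \<Rightarrow> ereal) \<Rightarrow> nat \<Rightarrow> 'a measure \<Rightarrow> ereal"
  where "tilde W n \<mu> =
    (if \<exists>x\<in>configs n. \<mu> = empirical n x
     then W n (SOME x. x \<in> configs n \<and> \<mu> = empirical n x)
     else \<infinity>)"

definition stable_sequence :: "(nat \<Rightarrow> (nat \<Rightarrow> 'a::topological_space) \<Rightarrow> ereal) \<Rightarrow> bool"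
  where "stable_sequence W \<longleftrightarrow> (\<exists>C::real. \<forall>n\<ge>1. \<forall>x\<in>configs n. W n x \<ge> ereal C)"

definition confining_sequence :: "(nat \<Rightarrow> (nat \<Rightarrow> 'a::topological_space) \<Rightarrow> ereal) \<Rightarrow> bool"
  where "confining_sequence W \<longleftrightarrow>
    (\<forall>(k :: nat \<Rightarrow> nat) \<mu>. strict_mono k \<longrightarrow> (\<forall>j. k j \<ge> 1) \<longrightarrow> (\<forall>j. \<mu> j \<in> borel_probs) \<longrightarrow>
      (\<exists>A::real. \<forall>j. tilde W (k j) (\<mu> j) \<le> ereal A) \<longrightarrow>
      relatively_compact_in weak_topology (range \<mu>))"

definition lower_limit_assumption ::
  "(nat \<Rightarrow> (nat \<Rightarrow> 'a::topological_space) \<Rightarrow> ereal) \<Rightarrow> ('a measure \<Rightarrow> ereal) \<Rightarrow> bool"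
  where "lower_limit_assumption Wn W \<longleftrightarrow>
    (\<forall>\<mu>s \<mu>. (\<forall>n. \<mu>s n \<in> borel_probs) \<longrightarrow> limitin weak_topology \<mu>s \<mu> sequentially \<longrightarrow>
      liminf (\<lambda>n. tilde Wn n (\<mu>s n)) \<ge> W \<mu>)"

definition upper_limit_at ::
  "(nat \<Rightarrow> (nat \<Rightarrow> 'a::topological_space) \<Rightarrow> ereal) \<Rightarrow> ('a measure \<Rightarrow> ereal) \<Rightarrow> 'a measure \<Rightarrow> bool"
  where "upper_limit_at Wn W \<mu> \<longleftrightarrow>
    limsup (\<lambda>n. ereal_integral (\<Pi>\<^sub>M i\<in>{..<n}. \<mu>) (Wn n)) \<le> W \<mu>"

definition regular_measures ::
  "'a::topological_space measure \<Rightarrow> (nat \<Rightarrow> (nat \<Rightarrow> 'a) \<Rightarrow> ereal) \<Rightarrow> ('a measure \<Rightarrow> ereal)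
    \<Rightarrow> 'a measure set"
  where "regular_measures \<pi> Wn W =
    {\<mu> \<in> borel_probs. rel_entropy \<mu> \<pi> < \<infinity> \<and> upper_limit_at Wn W \<mu>}"

definition regular_approximation ::
  "'a::topological_space measure \<Rightarrow> (nat \<Rightarrow> (nat \<Rightarrow> 'a) \<Rightarrow> ereal) \<Rightarrow> ('a measure \<Rightarrow> ereal) \<Rightarrow> bool"
  where "regular_approximation \<pi> Wn W \<longleftrightarrow>
    (\<forall>\<mu>\<in>borel_probs. W \<mu> < \<infinity> \<longrightarrow>
      (\<exists>\<mu>s. (\<forall>n. \<mu>s n \<in> regular_measures \<pi> Wn W) \<and>
        limitin weak_topology \<mu>s \<mu> sequentially \<and> limsup (\<lambda>n. W (\<mu>s n)) \<le> W \<mu>))"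

definition macroscopic_function :: "('a::topological_space measure \<Rightarrow> ereal) \<Rightarrow> bool"
  where "macroscopic_function W \<longleftrightarrow>
    W \<in> borel_measurable weak_borel \<and> (\<forall>\<mu>\<in>borel_probs. W \<mu> > -\<infinity>)"

definition positive_temperature_limit ::
  "(nat \<Rightarrow> (nat \<Rightarrow> 'a::topological_space) \<Rightarrow> ereal) \<Rightarrow> ('a measure \<Rightarrow> ereal) \<Rightarrow> bool"
  where "positive_temperature_limit Wn W \<longleftrightarrow>
    macroscopic_function W \<and> lower_limit_assumption Wn W \<and>
    (\<forall>\<mu>\<in>borel_probs. upper_limit_at Wn W \<mu>)"

definition zero_temperature_limit ::
  "'a::topological_space measure \<Rightarrow> (nat \<Rightarrow> (nat \<Rightarrow> 'a) \<Rightarrow> ereal) \<Rightarrow> ('a measure \<Rightarrow> ereal) \<Rightarrow> bool"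
  where "zero_temperature_limit \<pi> Wn W \<longleftrightarrow>
    macroscopic_function W \<and> lower_limit_assumption Wn W \<and> regular_approximation \<pi> Wn W"

end

theory Submission
  imports Defs
begin

text \<open>
  Lower bound: near-minimizers along a subsequence have bounded energy, so their empirical measures
  have a weakly convergent subsequence by the confining property, and (A1) bounds the energies from
  below by \<open>W\<close> at the limit. Upper bound: if \<open>W\<^sub>n + f \<circ> i\<^sub>n \<ge> a\<close> on \<open>M\<^sup>n\<close>, then \<open>W\<^sub>n \<ge> a - f(\<mu>) - \<epsilon>\<close>
  wherever \<open>f \<circ> i\<^sub>n < f(\<mu>) + \<epsilon>\<close>, and \<open>W\<^sub>n \<ge> a - sup f\<close> elsewhere. The exceptional set has vanishing
  \<open>\<mu>\<close>-product probability by the law of large numbers, so \<open>a \<le> W(\<mu>) + f(\<mu>)\<close> in the limit whenever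
  the mean energies under \<open>\<mu>\<close> are asymptotically at most \<open>W(\<mu>)\<close>; under (A2') such \<open>\<mu>\<close> suffice.
\<close>

section \<open>Borel probability measures and weakly continuous integrals\<close>

lemma borel_probsD:
  assumes "\<mu> \<in> borel_probs"
  shows "prob_space \<mu>" "sets \<mu> = sets borel" "space \<mu> = UNIV"
  using assms sets_eq_imp_space_eq[of \<mu> borel] by (auto simp: space_prob_algebra)

lemma integrable_bounded_continuous:
  fixes g :: "'a::topological_space \<Rightarrow> real"
  assumes "\<mu> \<in> borel_probs" "continuous_on UNIV g" "bounded (range g)"
  shows "integrable \<mu> g"
proof -
  interpret prob_space \<mu> using borel_probsD(1)[OF assms(1)] .
  obtain B where "\<And>x. norm (g x) \<le> B"
    using assms(3) by (auto simp: bounded_iff)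
  moreover have "g \<in> borel_measurable \<mu>"
    using borel_measurable_continuous_onI[OF assms(2)] borel_probsD(2)[OF assms(1)]
    by (simp add: measurable_def sets_eq_imp_space_eq[of \<mu> borel])
  ultimately show ?thesis
    by (intro integrable_const_bound[where B = B]) auto
qed

lemma continuous_map_weak_integral:
  fixes g :: "'a::topological_space \<Rightarrow> real"
  assumes "continuous_on UNIV g" "bounded (range g)"
  shows "continuous_map weak_topology euclideanreal (\<lambda>\<mu>. \<integral>x. g x \<partial>\<mu>)"
  unfolding continuous_map_def
proof (intro conjI allI impI)
  fix U :: "real set" assume "openin euclideanreal U"
  then show "openin weak_topology {\<mu> \<in> topspace weak_topology. (\<integral>x. g x \<partial>\<mu>) \<in> U}"
    using assms unfolding topspace_weak_topology unfolding weak_topology_def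
    by (intro topology_generated_by_Basis) auto
qed auto

section \<open>Separation of measures and sequential compactness\<close>

text \<open>The distance to the complement of a proper open set is positive exactly on that set, so
  its multiples, truncated at 1, tend to the indicator. Thus integrals of bounded continuous
  functions determine the mass of open sets.\<close>

lemma bounded_continuous_approx_open:
  fixes U :: "'a::metric_space set"
  assumes "open U"
  obtains g :: "nat \<Rightarrow> 'a \<Rightarrow> real"
  where "\<And>m. continuous_on UNIV (g m)" "\<And>m. range (g m) \<subseteq> {0..1}"
    "\<And>x. (\<lambda>m. g m x) \<longlonglongrightarrow> indicator U x"
\<comment> \<open>The distance \<open>infdist\<close> to the empty set is 0 by convention, so the
  formula for \<open>g\<close> below would give 0 instead of 1 on the whole space.\<close>
proof (cases "U = UNIV")
  case True
  then show ?thesis by (intro that[of "\<lambda>_ _. 1"]) auto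
next
  case False
  define g where "g m x = min 1 (real m * infdist x (- U))" for m x
  show ?thesis
  proof (rule that[of g])
    fix x
    show "(\<lambda>m. g m x) \<longlonglongrightarrow> indicator U x"
    proof (cases "x \<in> U")
      case True
      have d: "infdist x (- U) > 0"
        using assms False True by (intro infdist_pos_not_in_closed) auto
      obtain N where N: "1 \<le> real N * infdist x (- U)"
        using reals_Archimedean3[OF d] by (metis less_eq_real_def)
      have "eventually (\<lambda>m. g m x = 1) sequentially"
        using eventually_ge_at_top[of N]
      proof eventually_elim
        case (elim m)
        then have "real N * infdist x (- U) \<le> real m * infdist x (- U)"
          using d by (intro mult_right_mono) auto
        with N show ?case by (simp add: g_def)
      qed
      then show ?thesis using True by (simp add: tendsto_eventually)
    qed (auto simp: g_def)
  qed (auto simp: g_def infdist_nonneg intro!: continuous_intros)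
qed

text \<open>Such a family makes every weakly compact set of measures metrizable, hence sequentially compact,
  so metrizability of the whole weak topology (Prokhorov's metric) is not needed.\<close>

lemma countable_separating_family:
  obtains G :: "nat \<times> nat \<Rightarrow> 'a::polish_space \<Rightarrow> real"
  where "\<And>k. continuous_on UNIV (G k)" "\<And>k. bounded (range (G k))"
    "inj_on (\<lambda>\<mu> k. \<integral>x. G k x \<partial>\<mu>) borel_probs"
proof -
  obtain \<B> :: "'a set set" where \<B>: "countable \<B>" "topological_basis \<B>"
    using ex_countable_basis by blast
  \<comment> \<open>Finite intersections turn the countable basis into a countable pi-system
    generating the Borel sets. The empty intersection puts \<open>UNIV\<close> into it, which later
    serves as the covering sequence in the uniqueness theorem.\<close>
  define \<E> where "\<E> = Inter ` {F. F \<subseteq> \<B> \<and> finite F}"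
  have cE: "countable \<E>"
    unfolding \<E>_def using countable_Collect_finite_subset[OF \<B>(1)]
    by (simp add: conj_commute)
  have U\<E>: "UNIV \<in> \<E>"
    unfolding \<E>_def by (rule image_eqI[of _ _ "{}"]) auto
  have open\<E>: "open E" if "E \<in> \<E>" for E
    using that topological_basis_open[OF \<B>(2)] by (auto simp: \<E>_def intro!: open_Inter)
  have Int\<E>: "Int_stable \<E>"
  proof (rule Int_stableI)
    fix A B assume "A \<in> \<E>" "B \<in> \<E>"
    then obtain F F' where "A = \<Inter>F" "B = \<Inter>F'" "F \<subseteq> \<B>" "F' \<subseteq> \<B>" "finite F" "finite F'"
      by (auto simp: \<E>_def)
    then show "A \<inter> B \<in> \<E>"
      unfolding \<E>_def by (intro image_eqI[of _ _ "F \<union> F'"]) auto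
  qed
  have sub: "\<B> \<subseteq> \<E>"
    unfolding \<E>_def by (auto intro!: image_eqI[of _ _ "{_}"])
  have gen: "sets borel = sigma_sets UNIV \<E>"
  proof -
    have "sets (borel :: 'a measure) = sigma_sets UNIV \<B>"
      by (subst borel_eq_countable_basis[OF \<B>]) (rule sets_measure_of, simp)
    also have "\<dots> \<subseteq> sigma_sets UNIV \<E>"
      by (intro sigma_sets_mono' sub)
    finally have "sets (borel :: 'a measure) \<subseteq> sigma_sets UNIV \<E>" .
    moreover have "\<E> \<subseteq> sets borel" using open\<E> by auto
    from sets.sigma_sets_subset[OF this] have "sigma_sets UNIV \<E> \<subseteq> sets (borel :: 'a measure)"
      by simp
    ultimately show ?thesis by blast
  qed
  define V where "V = from_nat_into \<E>"
  have V: "V n \<in> \<E>" for n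
    unfolding V_def using U\<E> by (intro from_nat_into) auto
  have "\<exists>g. (\<forall>m. continuous_on UNIV (g m)) \<and> (\<forall>m. range (g m) \<subseteq> {0..1}) \<and>
    (\<forall>x. (\<lambda>m. g m x) \<longlonglongrightarrow> indicat_real (V n) x)" for n
    using bounded_continuous_approx_open[OF open\<E>[OF V[of n]]] by metis
  then obtain g :: "nat \<Rightarrow> nat \<Rightarrow> 'a \<Rightarrow> real" where g: "\<And>n m. continuous_on UNIV (g n m)"
    "\<And>n m. range (g n m) \<subseteq> {0..1}" "\<And>n x. (\<lambda>m. g n m x) \<longlonglongrightarrow> indicator (V n) x"
    by metis
  \<comment> \<open>The first index selects the open set \<open>V n\<close>, the second its
    continuous approximation.\<close>
  define G where "G k = g (fst k) (snd k)" for k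
  have bG: "bounded (range (G k))" for k
    using bounded_subset[OF bounded_closed_interval g(2)] by (simp add: G_def)
  show ?thesis
  proof (rule that[of G])
    show "inj_on (\<lambda>\<mu> k. \<integral>x. G k x \<partial>\<mu>) borel_probs"
    proof (rule inj_onI)
      fix \<mu> \<nu> :: "'a measure"
      assume \<mu>: "\<mu> \<in> borel_probs" and \<nu>: "\<nu> \<in> borel_probs"
        and eq: "(\<lambda>k. \<integral>x. G k x \<partial>\<mu>) = (\<lambda>k. \<integral>x. G k x \<partial>\<nu>)"
      \<comment> \<open>Dominated convergence recovers the mass of each \<open>V n\<close> from the
        integrals; agreement on the pi-system then forces equality of the measures.\<close>
      have lim: "(\<lambda>m. \<integral>x. G (n, m) x \<partial>\<rho>) \<longlonglongrightarrow> measure \<rho> (V n)"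
        if \<rho>: "\<rho> \<in> borel_probs" for \<rho> n
      proof -
        interpret prob_space \<rho> using borel_probsD(1)[OF \<rho>] .
        have Vs: "V n \<in> sets \<rho>"
          using open\<E>[OF V] borel_probsD(2)[OF \<rho>] by simp
        have "(\<lambda>m. \<integral>x. G (n, m) x \<partial>\<rho>) \<longlonglongrightarrow> (\<integral>x. indicator (V n) x \<partial>\<rho>)"
        proof (rule integral_dominated_convergence[where w = "\<lambda>_. 1"])
          show "G (n, m) \<in> borel_measurable \<rho>" for m
            using integrable_bounded_continuous[OF \<rho> _ bG[of "(n, m)"]] g(1)
            by (simp add: G_def borel_measurable_integrable)
          show "AE x in \<rho>. (\<lambda>m. G (n, m) x) \<longlonglongrightarrow> indicat_real (V n) x"
            using g(3) by (simp add: G_def)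
          show "AE x in \<rho>. norm (G (n, m) x) \<le> 1" for m
            using g(2)[of n m] by (auto simp: G_def image_subset_iff)
        qed (use Vs in auto)
        then show ?thesis using Vs by simp
      qed
      interpret M: prob_space \<mu> using borel_probsD(1)[OF \<mu>] .
      interpret N: prob_space \<nu> using borel_probsD(1)[OF \<nu>] .
      have "measure \<mu> (V n) = measure \<nu> (V n)" for n
        using LIMSEQ_unique[OF lim[OF \<mu>, of n]] lim[OF \<nu>, of n] fun_cong[OF eq] by simp
      then have "emeasure \<mu> E = emeasure \<nu> E" if "E \<in> \<E>" for E
        using from_nat_into_surj[OF cE that]
        by (auto simp: V_def M.emeasure_eq_measure N.emeasure_eq_measure)
      then show "\<mu> = \<nu>"
        using Int\<E> gen borel_probsD(2)[OF \<mu>] borel_probsD(2)[OF \<nu>] U\<E>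
        by (intro measure_eqI_generator_eq[where E = \<E> and \<Omega> = UNIV and A = "\<lambda>_. UNIV"]) auto
    qed
  qed (use g(1) bG in \<open>auto simp: G_def\<close>)
qed

text \<open>Integration against the separating family maps the compact closure continuously and
  injectively into a countable product of real lines. From a compact space to a Hausdorff space such
  a map is an embedding, so the closure is metrizable and compactness yields convergent
  subsequences.\<close>

lemma relatively_compact_in_weak_subseq:
  fixes \<mu> :: "nat \<Rightarrow> 'a::polish_space measure"
  assumes "relatively_compact_in weak_topology (range \<mu>)"
  obtains \<nu> r where "\<nu> \<in> borel_probs" "strict_mono r"
    "limitin weak_topology (\<mu> \<circ> r) \<nu> sequentially"
proof -
  obtain G :: "nat \<times> nat \<Rightarrow> 'a \<Rightarrow> real"
    where G: "\<And>k. continuous_on UNIV (G k)" "\<And>k. bounded (range (G k))"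
      "inj_on (\<lambda>\<mu> k. \<integral>x. G k x \<partial>\<mu>) borel_probs"
    using countable_separating_family by blast
  define K where "K = weak_topology closure_of (range \<mu>)"
  have K: "compactin weak_topology K" "range \<mu> \<subseteq> K" "K \<subseteq> borel_probs"
    using assms closure_of_subset[of "range \<mu>" weak_topology]
      closure_of_subset_topspace[of weak_topology "range \<mu>"]
    by (auto simp: relatively_compact_in_def K_def)
  define X where "X = subtopology weak_topology K"
  have tX: "topspace X = K" using K(3) by (auto simp: X_def)
  have cX: "compact_space X"
    using K(1) by (simp add: X_def compactin_subspace)
  define Y where "Y = product_topology (\<lambda>_ :: nat \<times> nat. euclideanreal) UNIV"
  have mY: "metrizable_space Y"
    unfolding Y_def metrizable_space_product_topology
    by (simp add: metrizable_space_euclidean)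
  have "continuous_map X Y (\<lambda>\<mu> k. \<integral>x. G k x \<partial>\<mu>)"
    unfolding X_def Y_def continuous_map_componentwise_UNIV
    by (intro allI continuous_map_from_subtopology continuous_map_weak_integral G)
  moreover have "inj_on (\<lambda>\<mu> k. \<integral>x. G k x \<partial>\<mu>) (topspace X)"
    using inj_on_subset[OF G(3) K(3)] by (simp add: tX)
  ultimately have "embedding_map X Y (\<lambda>\<mu> k. \<integral>x. G k x \<partial>\<mu>)"
    using cX mY by (intro continuous_imp_embedding_map metrizable_imp_Hausdorff_space)
  then have "metrizable_space X"
    using homeomorphic_metrizable_space[OF embedding_map_imp_homeomorphic_space]
      metrizable_space_subtopology[OF mY] by blast
  then obtain M d where Md: "Metric_space M d" "X = Metric_space.mtopology M d"
    by (auto simp: metrizable_space_def)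
  interpret Metric_space M d using Md(1) .
  have "M = K" using tX Md(2) by simp
  then obtain \<nu> r where "\<nu> \<in> M" "strict_mono r" "limitin X (\<mu> \<circ> r) \<nu> sequentially"
    using cX K(2) unfolding Md(2) compact_space_sequentially by blast
  with \<open>M = K\<close> K(3) show ?thesis
    by (intro that[of \<nu> r]) (auto simp: X_def limitin_subtopology)
qed

section \<open>Empirical measures and symmetric energies\<close>

text \<open>Seen as a push-forward of the uniform law on the indices, the empirical measure gets its
  integral formula from change of variables.\<close>

lemma empirical_eq_distr:
  assumes "n \<ge> 1"
  shows "empirical n x = distr (uniform_count_measure {..<n}) borel x"
proof (rule measure_eqI)
  fix A assume "A \<in> sets (empirical n x)"
  then have A: "A \<in> sets borel" by (simp add: sets_empirical)
  have m: "x \<in> measurable (uniform_count_measure {..<n}) borel"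
    by (simp add: measurable_def space_uniform_count_measure sets_uniform_count_measure)
  have "(\<Sum>i<n. emeasure (return borel (x i)) A) = of_nat (card {i. i < n \<and> x i \<in> A})"
    using A by (simp add: indicator_def of_bool_def sum.If_cases Int_def)
  moreover have "emeasure (distr (uniform_count_measure {..<n}) borel x) A
      = of_nat (card {i. i < n \<and> x i \<in> A}) / of_nat n"
  proof -
    have "x -` A \<inter> space (uniform_count_measure {..<n}) = {i. i < n \<and> x i \<in> A}"
      by (auto simp: space_uniform_count_measure)
    then show ?thesis
      using A m assms
      by (simp add: emeasure_distr emeasure_uniform_count_measure subset_iff
          divide_ennreal[symmetric] ennreal_of_nat_eq_real_of_nat)
  qed
  ultimately show "emeasure (empirical n x) A = emeasure (distr (uniform_count_measure {..<n}) borel x) A"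
    using A by (simp add: emeasure_empirical)
qed (simp add: sets_empirical)

lemma integral_empirical:
  fixes g :: "'a::topological_space \<Rightarrow> real"
  assumes "n \<ge> 1" "g \<in> borel_measurable borel"
  shows "(\<integral>y. g y \<partial>empirical n x) = (\<Sum>i<n. g (x i)) / real n"
proof -
  have "x \<in> measurable (uniform_count_measure {..<n}) borel"
    by (simp add: measurable_def space_uniform_count_measure sets_uniform_count_measure)
  then show ?thesis
    using assms by (simp add: empirical_eq_distr integral_distr integral_uniform_count_measure)
qed

text \<open>In a T1 space points are Borel sets, so \<open>n\<close> times the mass of a point is
  its multiplicity in the configuration. Equal multisets of values are related by a permutation of
  the indices.\<close>

lemma empirical_eq_imp_permuted:
  fixes x y :: "nat \<Rightarrow> 'a::t1_space"
  assumes n: "n \<ge> 1" and x: "x \<in> configs n" and y: "y \<in> configs n"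
    and eq: "empirical n x = empirical n y"
  obtains p where "p permutes {..<n}" "x = y \<circ> p"
proof -
  have count: "card {i. i < n \<and> z i = a} = n * measure (empirical n z) {a}" for z :: "nat \<Rightarrow> 'a" and a
  proof -
    have "measure (empirical n z) {a} = (\<integral>y. indicator {a} y \<partial>empirical n z)"
      by (simp add: sets_empirical)
    also have "\<dots> = (\<Sum>i<n. indicator {a} (z i)) / real n"
      using n by (intro integral_empirical) auto
    also have "(\<Sum>i<n. indicator {a} (z i)) = real (card {i. i < n \<and> z i = a})"
      by (simp add: indicator_def of_bool_def sum.If_cases Int_def)
    finally show ?thesis using n by simp
  qed
  have "image_mset x (mset_set {..<n}) = image_mset y (mset_set {..<n})"
  proof (rule multiset_eqI)
    fix a
    have "card {i. i < n \<and> x i = a} = card {i. i < n \<and> y i = a}"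
      using count[of x a] count[of y a] eq by simp
    moreover have "count (image_mset z (mset_set {..<n})) a = card {i. i < n \<and> z i = a}" for z :: "nat \<Rightarrow> 'a"
      by (simp add: count_image_mset Int_def vimage_def conj_commute)
    ultimately show "count (image_mset x (mset_set {..<n})) a = count (image_mset y (mset_set {..<n})) a"
      by simp
  qed
  from image_mset_eq_implies_permutes[OF _ this]
  obtain p where p: "p permutes {..<n}" "\<forall>i\<in>{..<n}. x i = y (p i)" by auto
  have "x i = (y \<circ> p) i" for i
  proof (cases "i < n")
    \<comment> \<open>The multiset argument speaks only of indices below \<open>n\<close>; beyond
      them both extensional functions are \<open>undefined\<close> and \<open>p\<close> is the
      identity.\<close>
    case False
    then have "p i = i" using p(1) by (simp add: permutes_def)
    then show ?thesis using x y False by (auto simp: PiE_def extensional_def)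
  qed (use p(2) in auto)
  then show ?thesis using that p(1) by blast
qed

text \<open>Links the hypotheses phrased through \<open>tilde\<close> to actual configurations: the
  representative picked by \<open>SOME\<close> is a permutation of \<open>x\<close>, and the energy
  is symmetric.\<close>

lemma tilde_empirical:
  fixes x :: "nat \<Rightarrow> 'a::t1_space"
  assumes "energy_sequence W" "n \<ge> 1" "x \<in> configs n"
  shows "tilde W n (empirical n x) = W n x"
proof -
  define y where "y = (SOME y. y \<in> configs n \<and> empirical n x = empirical n y)"
  have y: "y \<in> configs n \<and> empirical n x = empirical n y"
    unfolding y_def by (rule someI[of _ x]) (use assms in auto)
  then obtain p where "p permutes {..<n}" "x = y \<circ> p"
    using empirical_eq_imp_permuted[OF assms(2,3)] by blast
  then have "W n x = W n y"
    using assms(1,2) y unfolding energy_sequence_def by blast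
  moreover have "tilde W n (empirical n x) = W n y"
    unfolding tilde_def y_def using assms(3) by auto
  ultimately show ?thesis by simp
qed

section \<open>Extended integrals and the law of large numbers\<close>

text \<open>Positive and negative parts are compared separately. Integrability of \<open>l\<close>
  makes the integral of the negative part of \<open>h\<close> finite, so the difference is never
  infinity minus infinity.\<close>

lemma ereal_integral_ge:
  assumes l: "integrable N l" and le: "\<And>x. x \<in> space N \<Longrightarrow> ereal (l x) \<le> h x"
  shows "ereal (\<integral>x. l x \<partial>N) \<le> ereal_integral N h"
proof -
  obtain r q where rq: "0 \<le> r" "0 \<le> q" "(\<integral>\<^sup>+x. ennreal (l x) \<partial>N) = ennreal r"
    "(\<integral>\<^sup>+x. ennreal (- l x) \<partial>N) = ennreal q" "integral\<^sup>L N l = r - q"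
    using integrableE[OF l] by metis
  have "(\<integral>\<^sup>+x. ennreal (l x) \<partial>N) \<le> (\<integral>\<^sup>+x. e2ennreal (h x) \<partial>N)"
    using le by (intro nn_integral_mono) (metis e2ennreal_ereal e2ennreal_mono)
  then have "ereal r \<le> enn2ereal (\<integral>\<^sup>+x. e2ennreal (h x) \<partial>N)"
    using rq by (simp add: less_eq_ennreal.rep_eq)
  moreover have "(\<integral>\<^sup>+x. e2ennreal (- h x) \<partial>N) \<le> (\<integral>\<^sup>+x. ennreal (- l x) \<partial>N)"
    using le by (intro nn_integral_mono)
      (metis e2ennreal_ereal e2ennreal_mono ereal_minus_le_minus uminus_ereal.simps(1))
  then have "enn2ereal (\<integral>\<^sup>+x. e2ennreal (- h x) \<partial>N) \<le> ereal q"
    using rq by (simp add: less_eq_ennreal.rep_eq)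
  ultimately have "ereal r - ereal q \<le> ereal_integral N h"
    unfolding ereal_integral_def by (rule ereal_minus_mono)
  then show ?thesis using rq by simp
qed

text \<open>Hoeffding's inequality on each finite product bounds the deviation probability by a term
  decaying exponentially in \<open>n\<close>.\<close>

lemma weak_law_of_large_numbers_PiM:
  fixes g :: "'a \<Rightarrow> real"
  assumes "prob_space \<mu>" and g[measurable]: "g \<in> borel_measurable \<mu>" and B: "\<And>x. \<bar>g x\<bar> \<le> B"
    and "\<epsilon> > 0"
  shows "(\<lambda>n. measure (\<Pi>\<^sub>M i\<in>{..<n}. \<mu>) {x \<in> space (\<Pi>\<^sub>M i\<in>{..<n}. \<mu>).
    \<bar>(\<Sum>i<n. g (x i)) / real n - (\<integral>y. g y \<partial>\<mu>)\<bar> \<ge> \<epsilon>}) \<longlonglongrightarrow> 0"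
    (is "(\<lambda>n. measure (?P n) (?E n)) \<longlonglongrightarrow> 0")
proof -
  \<comment> \<open>Adding 1 gives the interval from \<open>-b\<close> to \<open>b\<close> positive
    length, so the denominator in Hoeffding's exponent does not vanish.\<close>
  define b where "b = \<bar>B\<bar> + 1"
  have b: "b > 0" "\<And>x. -b \<le> g x \<and> g x \<le> b"
    using B by (auto simp: b_def abs_le_iff) (smt (verit, best) B)+
  have bound: "measure (?P n) (?E n) \<le> 2 * exp (- 2 * real n * \<epsilon>\<^sup>2 / (b - (-b))\<^sup>2)" if n: "n \<ge> 1" for n
  proof -
    interpret P: prob_space "?P n"
      by (intro prob_space_PiM assms(1))
    have dc: "distr (?P n) \<mu> (\<lambda>x. x i) = \<mu>" if "i < n" for i
      using distr_PiM_component[of "{..<n}" "\<lambda>_. \<mu>" i] that assms(1) by simp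
    have "P.indep_vars (\<lambda>_. \<mu>) (\<lambda>i x. x i) {..<n}"
    \<comment> \<open>Independence means that the joint law is the product of the marginals;
      restriction to \<open>{..<n}\<close> is the identity on the product space.\<close>
    proof (subst P.indep_vars_iff_distr_eq_PiM')
      have "distr (?P n) (?P n) (\<lambda>x. restrict x {..<n}) = distr (?P n) (?P n) (\<lambda>x. x)"
        by (intro distr_cong refl) (auto simp: space_PiM)
      also have "\<dots> = ?P n" by (rule distr_id2) simp
      also have "\<dots> = (\<Pi>\<^sub>M i\<in>{..<n}. distr (?P n) \<mu> (\<lambda>x. x i))"
        by (intro PiM_cong refl) (simp add: dc)
      finally show "distr (?P n) (?P n) (\<lambda>x. \<lambda>i\<in>{..<n}. x i)
        = (\<Pi>\<^sub>M i\<in>{..<n}. distr (?P n) \<mu> (\<lambda>x. x i))" .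
    qed (use n in \<open>auto simp: lessThan_empty_iff\<close>)
    then have ind: "P.indep_vars (\<lambda>_. borel) (\<lambda>i x. g (x i)) {..<n}"
      by (rule P.indep_vars_compose2) simp
    have distr_g: "distr (?P n) borel (\<lambda>x. g (x i)) = distr \<mu> borel g" if "i < n" for i
    proof -
      have "distr (?P n) borel (\<lambda>x. g (x i)) = distr (distr (?P n) \<mu> (\<lambda>x. x i)) borel g"
        using that by (subst distr_distr) (auto simp: o_def)
      then show ?thesis using dc[OF that] by simp
    qed
    \<comment> \<open>Coordinate 0, which exists because \<open>n\<close> is positive, serves as the
      reference variable for the common law.\<close>
    interpret H: Hoeffding_ineq_iid "?P n" "{..<n}" "\<lambda>i x. g (x i)" "\<lambda>x. g (x 0)" "-b" b
      "\<integral>x. g (x 0) \<partial>?P n"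
    proof unfold_locales
      show "(\<lambda>x. g (x 0)) \<in> borel_measurable (?P n)"
        by measurable (use n in simp)
    qed (use n ind distr_g[of 0] distr_g b in auto)
    have "(\<integral>x. g (x 0) \<partial>?P n) = (\<integral>y. g y \<partial>distr (?P n) \<mu> (\<lambda>x. x 0))"
      using n by (intro integral_distr[symmetric]) auto
    also have "\<dots> = (\<integral>y. g y \<partial>\<mu>)" using n by (simp add: dc)
    finally have m: "(\<integral>x. g (x 0) \<partial>?P n) = (\<integral>y. g y \<partial>\<mu>)" .
    show ?thesis
      using H.Hoeffding_ineq_abs_ge'[of \<epsilon>] \<open>\<epsilon> > 0\<close> b(1) n unfolding m
      by (auto simp: lessThan_empty_iff)
  qed
  have "(\<lambda>n. 2 * exp (- (2 * \<epsilon>\<^sup>2 / (b - (-b))\<^sup>2) * real n)) \<longlonglongrightarrow> 0"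
  proof -
    have "2 * \<epsilon>\<^sup>2 / (b - (-b))\<^sup>2 > 0" using b(1) \<open>\<epsilon> > 0\<close> by simp
    then have "filterlim (\<lambda>n. - (2 * \<epsilon>\<^sup>2 / (b - (-b))\<^sup>2) * real n) at_bot sequentially"
      by (intro filterlim_tendsto_neg_mult_at_bot[OF tendsto_const] filterlim_real_sequentially) auto
    from filterlim_compose[OF exp_at_bot this] show ?thesis
      by (intro tendsto_mult_right_zero)
  qed
  then show ?thesis
  proof (rule tendsto_sandwich[OF _ _ tendsto_const, rotated 2])
    show "\<forall>\<^sub>F n in sequentially. measure (?P n) (?E n) \<le> 2 * exp (- (2 * \<epsilon>\<^sup>2 / (b - (-b))\<^sup>2) * real n)"
      using eventually_ge_at_top[of 1] by eventually_elim (use bound in \<open>simp add: mult_ac\<close>)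
  qed auto
qed

text \<open>The exceptional set is enclosed in a measurable one, so that no measurability of the map
  \<open>x \<mapsto> empirical n x\<close> is needed.\<close>

lemma empirical_weak_neighbourhood:
  fixes \<mu> :: "'a::topological_space measure"
  assumes \<mu>: "\<mu> \<in> borel_probs" and "openin weak_topology V" "\<mu> \<in> V"
  obtains E where "\<And>n. E n \<in> sets (\<Pi>\<^sub>M i\<in>{..<n}. \<mu>)"
    "\<And>n x. n \<ge> 1 \<Longrightarrow> x \<in> configs n - E n \<Longrightarrow> empirical n x \<in> V"
    "(\<lambda>n. measure (\<Pi>\<^sub>M i\<in>{..<n}. \<mu>) (E n)) \<longlonglongrightarrow> 0"
proof -
  let ?P = "\<lambda>n. \<Pi>\<^sub>M i\<in>{..<n}. \<mu>"
  let ?Q = "\<lambda>V E. (\<forall>n. E n \<in> sets (?P n)) \<and>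
    (\<forall>n\<ge>1. \<forall>x\<in>configs n - E n. empirical n x \<in> V) \<and>
    (\<lambda>n. measure (?P n) (E n)) \<longlonglongrightarrow> 0"
  have "generate_topology_on {{\<mu> \<in> borel_probs. (\<integral>x. g x \<partial>\<mu>) \<in> U} | (g :: 'a \<Rightarrow> real) U.
       continuous_on UNIV g \<and> bounded (range g) \<and> open U} V"
    using assms(2) by (simp add: weak_topology_def openin_topology_generated_by_iff)
  \<comment> \<open>Induction on the generation of \<open>V\<close> reduces the claim to subbasic
    sets, where the law of large numbers for one function applies. An intersection takes the union
    of two exceptional sets; a union keeps the one of a member containing the measure.\<close>
  then have "\<exists>E. ?Q V E" using assms(3)
  proof induction
    case Empty
    then show ?case by simp
  next
    case (Int V V')
    then obtain E E' where E: "?Q V E" "?Q V' E'" by auto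
    have fin: "finite_measure (?P n)" for n
      using prob_space_PiM[of "{..<n}" "\<lambda>_. \<mu>"] borel_probsD(1)[OF \<mu>]
      by (simp add: prob_space.finite_measure)
    have "(\<lambda>n. measure (?P n) (E n \<union> E' n)) \<longlonglongrightarrow> 0"
    proof (rule tendsto_sandwich[OF _ _ tendsto_const])
      show "(\<lambda>n. measure (?P n) (E n) + measure (?P n) (E' n)) \<longlonglongrightarrow> 0"
        using E by (auto intro: tendsto_add_zero)
      show "\<forall>\<^sub>F n in sequentially. measure (?P n) (E n \<union> E' n)
          \<le> measure (?P n) (E n) + measure (?P n) (E' n)"
        using E by (intro always_eventually allI measure_Un_le) auto
    qed auto
    then have "?Q (V \<inter> V') (\<lambda>n. E n \<union> E' n)" using E by auto
    then show ?case by (rule exI[of _ "\<lambda>n. E n \<union> E' n"])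
  next
    case (UN \<K>)
    then obtain k where k: "k \<in> \<K>" "\<mu> \<in> k" by blast
    from UN.IH[OF this] obtain E where "?Q k E" by (rule exE)
    with k(1) have "?Q (\<Union>\<K>) E" by auto
    then show ?case by (rule exI[of _ E])
  next
    case (Basis V)
    then obtain g :: "'a \<Rightarrow> real" and U where V: "V = {\<mu> \<in> borel_probs. (\<integral>x. g x \<partial>\<mu>) \<in> U}"
      and g: "continuous_on UNIV g" "bounded (range g)" and U: "open U" by blast
    have "(\<integral>x. g x \<partial>\<mu>) \<in> U" using Basis V by simp
    with U obtain \<epsilon> where \<epsilon>: "\<epsilon> > 0" "\<And>t. \<bar>t - (\<integral>x. g x \<partial>\<mu>)\<bar> < \<epsilon> \<Longrightarrow> t \<in> U"
      by (auto simp: open_dist dist_real_def)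
    obtain B where B: "\<And>x. \<bar>g x\<bar> \<le> B" using g(2) by (auto simp: bounded_iff)
    have gb: "g \<in> borel_measurable borel"
      using g(1) by (rule borel_measurable_continuous_onI)
    have [measurable]: "g \<in> borel_measurable \<mu>"
      using integrable_bounded_continuous[OF \<mu> g] by (rule borel_measurable_integrable)
    define E where "E n = {x \<in> space (?P n). \<bar>(\<Sum>i<n. g (x i)) / real n - (\<integral>y. g y \<partial>\<mu>)\<bar> \<ge> \<epsilon>}" for n
    have sp: "space (?P n) = configs n" for n
      by (simp add: space_PiM borel_probsD(3)[OF \<mu>])
    have "?Q V E"
    proof (intro conjI allI impI ballI)
      show "E n \<in> sets (?P n)" for n unfolding E_def by measurable
      show "(\<lambda>n. measure (?P n) (E n)) \<longlonglongrightarrow> 0"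
        unfolding E_def using borel_probsD(1)[OF \<mu>] B \<epsilon>(1)
        by (intro weak_law_of_large_numbers_PiM[where B = B]) auto
      fix n x assume n: "n \<ge> (1::nat)" and "x \<in> configs n - E n"
      then have "\<bar>(\<Sum>i<n. g (x i)) / real n - (\<integral>y. g y \<partial>\<mu>)\<bar> < \<epsilon>"
        using sp by (auto simp: E_def)
      then show "empirical n x \<in> V"
        using \<epsilon>(2) empirical_in_borel_probs[OF n, of x] integral_empirical[OF n gb, of x]
        by (simp add: V)
    qed
    then show ?case by (rule exI[of _ E])
  qed
  then obtain E where "?Q V E" by (rule exE)
  then show ?thesis by (intro that[of E]) auto
qed

section \<open>The upper bound\<close>

text \<open>The estimate concerns a single measure, so it applies to every measure under (A2) and to
  the regular approximants under (A2').\<close>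

lemma limsup_inf_le:
  fixes Wn :: "nat \<Rightarrow> (nat \<Rightarrow> 'a::topological_space) \<Rightarrow> ereal" and f :: "'a measure \<Rightarrow> real"
  assumes f: "continuous_map weak_topology euclideanreal f" "bounded (f ` borel_probs)"
    and \<mu>: "\<mu> \<in> borel_probs" and up: "upper_limit_at Wn W \<mu>" and W: "W \<mu> > -\<infinity>"
  shows "limsup (\<lambda>n. INF x\<in>configs n. Wn n x + ereal (f (empirical n x))) \<le> W \<mu> + ereal (f \<mu>)"
    (is "limsup ?m \<le> _")
proof (rule ccontr)
  let ?P = "\<lambda>n. \<Pi>\<^sub>M i\<in>{..<n}. \<mu>"
  assume "\<not> ?thesis"
  then have "W \<mu> + ereal (f \<mu>) < limsup ?m" by simp
  then obtain a where a: "W \<mu> + ereal (f \<mu>) < ereal a" "ereal a < limsup ?m"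
    using ereal_dense2 by blast
  obtain w where w: "W \<mu> = ereal w" using W a(1) by (cases "W \<mu>") auto
  \<comment> \<open>A quarter of the gap: the neighbourhood of the measure, the exceptional set and
    the limsup of the mean energies cost one \<open>\<epsilon>\<close> each, leaving a
    contradiction.\<close>
  define \<epsilon> where "\<epsilon> = (a - w - f \<mu>) / 4"
  have \<epsilon>: "\<epsilon> > 0" using a(1) w by (simp add: \<epsilon>_def)
  obtain B where B: "\<And>\<nu>. \<nu> \<in> borel_probs \<Longrightarrow> \<bar>f \<nu>\<bar> \<le> B"
    using f(2) by (auto simp: bounded_iff)
  define V where "V = {\<nu> \<in> topspace weak_topology. f \<nu> \<in> {..<f \<mu> + \<epsilon>}}"
  have "openin weak_topology V"
    unfolding V_def using f(1) by (intro openin_continuous_map_preimage) auto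
  moreover have "\<mu> \<in> V" using \<mu> \<epsilon> by (simp add: V_def)
  ultimately obtain E where E: "\<And>n. E n \<in> sets (?P n)"
    "\<And>n x. n \<ge> 1 \<Longrightarrow> x \<in> configs n - E n \<Longrightarrow> empirical n x \<in> V"
    "(\<lambda>n. measure (?P n) (E n)) \<longlonglongrightarrow> 0"
    using empirical_weak_neighbourhood[OF \<mu>] by blast
  have lower: "ereal (a - f \<mu> - \<epsilon> - 2 * B * measure (?P n) (E n)) \<le> ereal_integral (?P n) (Wn n)"
    if n: "n \<ge> 1" and m: "ereal a < ?m n" for n
  proof -
    interpret P: prob_space "?P n"
      by (intro prob_space_PiM borel_probsD(1)[OF \<mu>])
    \<comment> \<open>On \<open>E n\<close> only the bound \<open>B\<close> on \<open>f\<close> is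
      available. Replacing \<open>f\<close> at the empirical measure by \<open>f \<mu>\<close> costs
      at most \<open>2 * B\<close> there, and at most \<open>\<epsilon>\<close> off
      \<open>E n\<close>.\<close>
    let ?l = "\<lambda>x. a - f \<mu> - \<epsilon> - 2 * B * indicator (E n) x"
    have int: "integrable (?P n) ?l"
      using E(1)[of n] by (auto simp: P.emeasure_eq_measure)
    have "ereal (\<integral>x. ?l x \<partial>?P n) \<le> ereal_integral (?P n) (Wn n)"
    proof (rule ereal_integral_ge[OF int])
      fix x assume "x \<in> space (?P n)"
      then have x: "x \<in> configs n" by (simp add: space_PiM borel_probsD(3)[OF \<mu>])
      have "ereal a < Wn n x + ereal (f (empirical n x))"
        using m x by (meson INF_lower less_le_trans)
      then have ge: "ereal (a - f (empirical n x)) \<le> Wn n x"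
        by (cases "Wn n x") auto
      have "f (empirical n x) \<le> B"
        using B[OF empirical_in_borel_probs[OF n, of x]] by simp
      moreover have "- B \<le> f \<mu>" using B[OF \<mu>] by simp
      moreover have "f (empirical n x) < f \<mu> + \<epsilon>" if "x \<notin> E n"
        using E(2)[OF n, of x] x that by (simp add: V_def)
      ultimately have "?l x \<le> a - f (empirical n x)"
        using \<epsilon> by (cases "x \<in> E n") auto
      with ge show "ereal (?l x) \<le> Wn n x"
        by (meson ereal_less_eq(3) order_trans)
    qed
    also have "(\<integral>x. ?l x \<partial>?P n) = a - f \<mu> - \<epsilon> - 2 * B * measure (?P n) (E n)"
      using E(1)[of n] by (subst Bochner_Integration.integral_diff)
        (auto simp: P.prob_space P.emeasure_eq_measure)
    finally show ?thesis .
  qed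
  have "limsup (\<lambda>n. ereal_integral (?P n) (Wn n)) < ereal (w + \<epsilon>)"
    using up w \<epsilon> unfolding upper_limit_at_def by (simp add: le_less_trans)
  then have "\<forall>\<^sub>F n in sequentially. ereal_integral (?P n) (Wn n) < ereal (w + \<epsilon>)"
    by (rule Limsup_lessD)
  moreover have "\<forall>\<^sub>F n in sequentially. 2 * B * measure (?P n) (E n) < \<epsilon>"
    using tendsto_mult_right_zero[OF E(3)] \<epsilon> by (rule order_tendstoD(2))
  \<comment> \<open>The limsup gives this inequality only for infinitely many \<open>n\<close>; the
    other conditions hold eventually, so some \<open>n\<close> meets them all.\<close>
  moreover have "\<exists>\<^sub>F n in sequentially. ereal a < ?m n"
  proof (rule ccontr)
    assume "\<not> ?thesis"
    then have "\<forall>\<^sub>F n in sequentially. ?m n \<le> ereal a" by (simp add: not_frequently not_less)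
    then have "limsup ?m \<le> ereal a" by (rule Limsup_bounded)
    with a(2) show False by simp
  qed
  ultimately have "\<exists>\<^sub>F n in sequentially. (ereal_integral (?P n) (Wn n) < ereal (w + \<epsilon>)
      \<and> 2 * B * measure (?P n) (E n) < \<epsilon> \<and> n \<ge> 1) \<and> ereal a < ?m n"
    using eventually_ge_at_top[of "1::nat"]
    by (intro frequently_eventually_conj eventually_conj)
  from frequently_ex[OF this]
  obtain n where n: "n \<ge> 1" "ereal a < ?m n" "2 * B * measure (?P n) (E n) < \<epsilon>"
    "ereal_integral (?P n) (Wn n) < ereal (w + \<epsilon>)" by blast
  have "ereal (a - f \<mu> - \<epsilon> - 2 * B * measure (?P n) (E n)) < ereal (w + \<epsilon>)"
    using lower[OF n(1,2)] n(4) by (rule le_less_trans)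
  moreover have "a = w + f \<mu> + 4 * \<epsilon>" by (simp add: \<epsilon>_def field_simps)
  ultimately show False using n(3) \<epsilon> by simp
qed

section \<open>The lower bound\<close>

lemma liminf_inf_ge:
  fixes Wn :: "nat \<Rightarrow> (nat \<Rightarrow> 'a::polish_space) \<Rightarrow> ereal" and f :: "'a measure \<Rightarrow> real"
  assumes f: "continuous_map weak_topology euclideanreal f" "bounded (f ` borel_probs)"
    and en: "energy_sequence Wn" and conf: "confining_sequence Wn"
    and low: "lower_limit_assumption Wn W"
  shows "(INF \<mu>\<in>borel_probs. W \<mu> + ereal (f \<mu>))
    \<le> liminf (\<lambda>n. INF x\<in>configs n. Wn n x + ereal (f (empirical n x)))" (is "?L \<le> liminf ?m")
proof (rule ccontr)
  assume "\<not> ?thesis"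
  then have "liminf ?m < ?L" by simp
  then obtain A where A: "liminf ?m < ereal A" "ereal A < ?L"
    using ereal_dense2 by blast
  obtain B where B: "\<And>\<nu>. \<nu> \<in> borel_probs \<Longrightarrow> \<bar>f \<nu>\<bar> \<le> B"
    using f(2) by (auto simp: bounded_iff)
  have "\<exists>\<^sub>F n in sequentially. ?m n < ereal A"
  proof (rule ccontr)
    assume "\<not> ?thesis"
    then have "\<forall>\<^sub>F n in sequentially. ereal A \<le> ?m n" by (simp add: not_frequently not_less)
    then have "ereal A \<le> liminf ?m" by (rule Liminf_bounded)
    with A(1) show False by simp
  qed
  then have "\<exists>\<^sub>F n in sequentially. n \<ge> 1 \<and> ?m n < ereal A"
    using eventually_ge_at_top[of "1::nat"] by (rule frequently_eventually_conj)
  then have "infinite {n. n \<ge> 1 \<and> ?m n < ereal A}"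
    by (simp add: frequently_cofinite cofinite_eq_sequentially[symmetric])
  then obtain k :: "nat \<Rightarrow> nat" where k: "strict_mono k" "\<And>j. ?m (k j) < ereal A" "\<And>j. k j \<ge> 1"
    using infinite_enumerate[of "{n. n \<ge> 1 \<and> ?m n < ereal A}"] by blast
  then have "\<exists>x. x \<in> configs (k j) \<and> Wn (k j) x + ereal (f (empirical (k j) x)) < ereal A" for j
    using k(2)[of j] unfolding INF_less_iff by blast
  then obtain x where x: "\<And>j. x j \<in> configs (k j)"
    "\<And>j. Wn (k j) (x j) + ereal (f (empirical (k j) (x j))) < ereal A" by metis
  define \<mu> where "\<mu> j = empirical (k j) (x j)" for j
  have \<mu>: "\<mu> j \<in> borel_probs" for j
    unfolding \<mu>_def using k(3) by (rule empirical_in_borel_probs)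
  have til: "tilde Wn (k j) (\<mu> j) = Wn (k j) (x j)" for j
    unfolding \<mu>_def using en k(3) x(1) by (rule tilde_empirical)
  have less: "tilde Wn (k j) (\<mu> j) < ereal (A - f (\<mu> j))" for j
    using x(2)[of j] unfolding til \<mu>_def[symmetric] by (cases "Wn (k j) (x j)") auto
  \<comment> \<open>Confinement asks for one bound for all \<open>j\<close>, so the varying term
    \<open>f (\<mu> j)\<close> is replaced by its bound.\<close>
  have "tilde Wn (k j) (\<mu> j) \<le> ereal (A + B)" for j
  proof -
    have "A - f (\<mu> j) \<le> A + B" using B[OF \<mu>, of j] by simp
    with less[of j] show ?thesis
      by (meson ereal_less_eq(3) less_imp_le order_trans)
  qed
  then have "relatively_compact_in weak_topology (range \<mu>)"
    using conf k(1,3) \<mu> unfolding confining_sequence_def by blast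
  then obtain \<nu> r where \<nu>: "\<nu> \<in> borel_probs" and r: "strict_mono r"
    and lim: "limitin weak_topology (\<mu> \<circ> r) \<nu> sequentially"
    by (rule relatively_compact_in_weak_subseq)
  define s where "s = k \<circ> r"
  have s: "strict_mono s" unfolding s_def using k(1) r by (rule strict_mono_o)
  \<comment> \<open>(A1) speaks of sequences indexed by all \<open>n\<close>. The gaps between the
    indices \<open>s j\<close> are filled with the limit itself, which preserves
    convergence.\<close>
  define \<mu>' where "\<mu>' n = (if n \<in> range s then \<mu> (r (inv s n)) else \<nu>)" for n
  have \<mu>'s: "\<mu>' (s j) = \<mu> (r j)" for j
    using strict_mono_imp_inj_on[OF s] by (simp add: \<mu>'_def)
  have lim': "limitin weak_topology \<mu>' \<nu> sequentially"
    unfolding limitin_sequentially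
  proof (intro conjI allI impI)
    fix U assume U: "openin weak_topology U \<and> \<nu> \<in> U"
    then obtain N where N: "\<And>j. j \<ge> N \<Longrightarrow> \<mu> (r j) \<in> U"
      using lim by (auto simp: limitin_sequentially)
    have "\<mu>' n \<in> U" if n: "n \<ge> s N" for n
    proof (cases "n \<in> range s")
      case True
      then obtain j where "n = s j" by blast
      with n s N \<mu>'s show ?thesis by (simp add: strict_mono_less_eq)
    qed (use U in \<open>simp add: \<mu>'_def\<close>)
    then show "\<exists>N. \<forall>n\<ge>N. \<mu>' n \<in> U" by blast
  qed (use \<nu> in simp)
  have "\<forall>n. \<mu>' n \<in> borel_probs" using \<mu> \<nu> by (simp add: \<mu>'_def)
  with low lim' have W: "W \<nu> \<le> liminf (\<lambda>n. tilde Wn n (\<mu>' n))"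
    unfolding lower_limit_assumption_def by blast
  have "ereal A < W \<nu> + ereal (f \<nu>)" using A(2) \<nu> by (meson INF_lower less_le_trans)
  then have "ereal (A - f \<nu>) < W \<nu>" by (cases "W \<nu>") auto
  \<comment> \<open>Eventually the energies exceed \<open>w\<close> while \<open>f\<close> exceeds
    \<open>A - w\<close>, so their sum exceeds \<open>A\<close>. Along \<open>s\<close> this
    contradicts the choice of the near-minimizers.\<close>
  then obtain w where w: "ereal (A - f \<nu>) < ereal w" "ereal w < W \<nu>"
    using ereal_dense2 by blast
  have "\<forall>\<^sub>F n in sequentially. ereal w < tilde Wn n (\<mu>' n)"
    using less_le_trans[OF w(2) W] by (rule less_LiminfD)
  moreover have "(\<lambda>n. f (\<mu>' n)) \<longlonglongrightarrow> f \<nu>"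
    using continuous_map_limit[OF f(1) lim'] by (simp add: o_def)
  then have "\<forall>\<^sub>F n in sequentially. A - w < f (\<mu>' n)"
    by (rule order_tendstoD(1)) (use w(1) in simp)
  ultimately have "\<forall>\<^sub>F n in sequentially. ereal w < tilde Wn n (\<mu>' n) \<and> A - w < f (\<mu>' n)"
    by (rule eventually_conj)
  from eventually_compose_filterlim[OF this filterlim_subseq[OF s]]
  obtain j where j: "ereal w < tilde Wn (s j) (\<mu>' (s j))" "A - w < f (\<mu>' (s j))"
    by (auto simp: eventually_sequentially)
  have "ereal w < ereal (A - f (\<mu> (r j)))"
    using j(1) less[of "r j"] unfolding \<mu>'s by (metis comp_apply less_ereal.simps(1) less_trans s_def)
  with j(2) show False by (simp add: \<mu>'s)
qed

section \<open>Convergence of the infima\<close>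

theorem theorem5p2:
  fixes \<pi> :: "'a::polish_space measure"
    and Wn :: "nat \<Rightarrow> (nat \<Rightarrow> 'a) \<Rightarrow> ereal"
    and W :: "'a measure \<Rightarrow> ereal"
    and f :: "'a measure \<Rightarrow> real"
  assumes "\<pi> \<in> borel_probs"
    and "energy_sequence Wn"
    and "stable_sequence Wn"
    and "confining_sequence Wn"
    and "positive_temperature_limit Wn W \<or> zero_temperature_limit \<pi> Wn W"
    and "continuous_map weak_topology euclideanreal f"
    and "bounded (f ` borel_probs)"
  shows "(\<lambda>n. INF x\<in>configs n. Wn n x + ereal (f (empirical n x)))
           \<longlonglongrightarrow> (INF \<mu>\<in>borel_probs. W \<mu> + ereal (f \<mu>))"
    (is "?m \<longlonglongrightarrow> ?L")
proof -
  have low: "lower_limit_assumption Wn W" and W: "\<And>\<mu>. \<mu> \<in> borel_probs \<Longrightarrow> W \<mu> > -\<infinity>"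
    using assms(5) by (auto simp: positive_temperature_limit_def zero_temperature_limit_def
        macroscopic_function_def)
  note up = limsup_inf_le[OF assms(6,7) _ _ W]
  have "limsup ?m \<le> W \<mu> + ereal (f \<mu>)" if \<mu>: "\<mu> \<in> borel_probs" for \<mu>
    using assms(5)
  proof
    assume "positive_temperature_limit Wn W"
    then show ?thesis
      using \<mu> by (auto simp: positive_temperature_limit_def intro: up)
  next
    assume zero: "zero_temperature_limit \<pi> Wn W"
    show ?thesis
    proof (cases "W \<mu> < \<infinity>")
      case True
      with zero \<mu> obtain \<mu>s where \<mu>s: "\<And>n. \<mu>s n \<in> regular_measures \<pi> Wn W"
        "limitin weak_topology \<mu>s \<mu> sequentially" "limsup (\<lambda>n. W (\<mu>s n)) \<le> W \<mu>"
        unfolding zero_temperature_limit_def regular_approximation_def by blast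
      have le: "limsup ?m \<le> W (\<mu>s k) + ereal (f (\<mu>s k))" for k
        using \<mu>s(1)[of k] by (auto simp: regular_measures_def intro: up)
      have "(\<lambda>k. f (\<mu>s k)) \<longlonglongrightarrow> f \<mu>"
        using continuous_map_limit[OF assms(6) \<mu>s(2)] by (simp add: o_def)
      then have lim: "(\<lambda>k. ereal (f (\<mu>s k))) \<longlonglongrightarrow> ereal (f \<mu>)" by simp
      \<comment> \<open>The left side does not depend on \<open>k\<close>, so the bounds at the
        approximants pass to their limsup. It splits in the next line because
        \<open>f (\<mu>s k)\<close> converges to a finite limit.\<close>
      have "limsup ?m \<le> limsup (\<lambda>k. ereal (f (\<mu>s k)) + W (\<mu>s k))"
        using le by (intro le_Limsup always_eventually) (auto simp: add.commute)
      also have "\<dots> = ereal (f \<mu>) + limsup (\<lambda>k. W (\<mu>s k))"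
        using lim by (rule ereal_limsup_lim_add) auto
      also have "\<dots> \<le> ereal (f \<mu>) + W \<mu>"
        using \<mu>s(3) by (rule add_left_mono)
      finally show ?thesis by (simp add: add.commute)
    qed auto
  qed
  then have "limsup ?m \<le> ?L" by (rule INF_greatest)
  moreover have "?L \<le> liminf ?m"
    using assms(6,7,2,4) low by (rule liminf_inf_ge)
  ultimately show ?thesis
    using Liminf_le_Limsup[of sequentially ?m]
    by (intro Liminf_eq_Limsup antisym) (auto intro: order_trans)
qed

end
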